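(* There is an absolute constant $C>0$ such that the following holds. Let $n,n_0,n_1,n_2$ be integers with $n_0\ge 0$, $n_1,n_2>0$, $n_0+n_1+n_2=n$, $\frac{n_1}{n_2}=\frac{54}{17}$, $n_0<568$, where $n_1$ is a multiple of $6$ and $n_2$ is a multiple of $8$. Let $k\in\mathbb N$ be given in binary form by $$k := \big( \underbrace{000\dots 00}_{n_0\ \text{digits}}\ \underbrace{00001111\,\dots\,00001111}_{n_2\ \text{digits}}\ \underbrace{000111\,\dots\,000111}_{n_1\ \text{digits}}\big)_2+1,$$ that is, $k-1$ has the $n$-digit binary expansion (most significant digit first) consisting of $n_0$ zeros, followed by the block $00001111$ repeated $n_2/8$ times, followed by the block $000111$ repeated $n_1/6$ times. Let $\alpha_0=1-\frac{k}{2^n}$ and $N=2^n$. Then the cyclically shifted van der Corput set $\mathcal V_n^{\alpha_0}$ satisfies $$\|D_{\mathcal V_n^{\alpha_0}}\|_2\le C\, n^{1/2},$$ that is, $\|D_{\mathcal V_n^{\alpha_0}}\|_2\lesssim n^{1/2}\approx(\log N)^{1/2}$.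
   Context: For a finite set $\mathcal A_N\subset[0,1]^2$ of cardinality $N$, the discrepancy function is $D_{\mathcal A_N}(x_1,x_2)=\sharp\big(\mathcal A_N\cap[0,x_1)\times[0,x_2)\big)-N x_1 x_2$ for $(x_1,x_2)\in[0,1]^2$, and $\|\cdot\|_2$ is the norm of $L^2([0,1]^2)$ with Lebesgue measure. The van der Corput set with $N=2^n$ points is $$\mathcal V_n=\{(0.a_1a_2\dots a_n1,\ 0.a_na_{n-1}\dots a_2a_11):\ a_i\in\{0,1\}\},$$ where coordinates are written in binary (each coordinate has a final digit $1$ in the $(n+1)$st binary place). For $\alpha\in[0,1)$ its cyclic shift is $\mathcal V_n^\alpha=\{((x+\alpha)\bmod 1,\ y):\ (x,y)\in\mathcal V_n\}$. The symbol $\lesssim$ means at most an absolute constant multiple of. *)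

theory Defs
  imports "HOL-Analysis.Analysis"
begin

definition discrepancy :: "(real \<times> real) set \<Rightarrow> real \<times> real \<Rightarrow> real" where
  "discrepancy A = (\<lambda>(x1, x2).
     real (card (A \<inter> {0..<x1} \<times> {0..<x2})) - real (card A) * x1 * x2)"

abbreviation unit_square :: "(real \<times> real) set" where
  "unit_square \<equiv> {0..1} \<times> {0..1}"

definition L2_norm_square :: "(real \<times> real \<Rightarrow> real) \<Rightarrow> real" where
  "L2_norm_square f = sqrt (LINT x:unit_square|lborel. (f x)\<^sup>2)"

text \<open>Digit strings are written most significant digit first, hence the reversal for
  \<open>horner_sum\<close>, which starts with the least significant digit.\<close>

definition binary_nat :: "nat list \<Rightarrow> nat" where
  "binary_nat ds = horner_sum id 2 (rev ds)"

definition binary_fraction :: "nat list \<Rightarrow> real" where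
  "binary_fraction ds = (\<Sum>i<length ds. real (ds ! i) / 2 ^ (i + 1))"

definition van_der_corput_set :: "nat \<Rightarrow> (real \<times> real) set" where
  "van_der_corput_set n =
     {(binary_fraction (a @ [1]), binary_fraction (rev a @ [1])) | a.
        length a = n \<and> set a \<subseteq> {0, 1}}"

definition cyclic_shift :: "real \<Rightarrow> (real \<times> real) set \<Rightarrow> (real \<times> real) set" where
  "cyclic_shift \<alpha> A = (\<lambda>(x, y). (frac (x + \<alpha>), y)) ` A"

definition shift_index :: "nat \<Rightarrow> nat \<Rightarrow> nat \<Rightarrow> nat" where
  "shift_index n0 n1 n2 = binary_nat
     (replicate n0 0
      @ concat (replicate (n2 div 8) [0, 0, 0, 0, 1, 1, 1, 1])
      @ concat (replicate (n1 div 6) [0, 0, 0, 1, 1, 1])) + 1"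

text \<open>The Bochner integral of a non-integrable function is \<open>0\<close> by convention; the following
  shows that this does not interfere with the norm of a discrepancy function.\<close>

lemma discrepancy_square_integrable:
  assumes "finite A"
  shows "set_integrable lborel unit_square (\<lambda>x. (discrepancy A x)\<^sup>2)"
proof -
  define g :: "real \<times> real \<Rightarrow> real" where
    "g x = (\<Sum>p\<in>A. indicator {q. 0 \<le> fst p \<and> fst p < fst q} x
                    * indicator {q. 0 \<le> snd p \<and> snd p < snd q} x)" for x
  have D: "discrepancy A x = g x - real (card A) * fst x * snd x" for x
  proof -
    have "real (card (A \<inter> {0..<fst x} \<times> {0..<snd x}))
        = real (\<Sum>p\<in>A. indicator ({0..<fst x} \<times> {0..<snd x}) p)"
      by (simp only: sum_indicator_eq_card[OF assms])
    also have "\<dots> = g x"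
      unfolding g_def of_nat_sum
      by (intro sum.cong refl) (simp add: indicator_def mem_Times_iff)
    finally show ?thesis
      by (simp add: discrepancy_def case_prod_beta)
  qed
  have "{q :: real \<times> real. a < fst q} \<in> sets borel"
       "{q :: real \<times> real. a < snd q} \<in> sets borel" for a
    by (intro borel_open open_Collect_less continuous_intros)+
  then have sets: "{q :: real \<times> real. 0 \<le> fst p \<and> fst p < fst q} \<in> sets borel"
                  "{q :: real \<times> real. 0 \<le> snd p \<and> snd p < snd q} \<in> sets borel"
    for p :: "real \<times> real"
    by (cases "0 \<le> fst p"; cases "0 \<le> snd p"; simp)+
  have gm: "g \<in> borel_measurable borel"
    unfolding g_def using sets
    by (intro borel_measurable_sum borel_measurable_times borel_measurable_indicator)
  have "(\<lambda>x. (discrepancy A x)\<^sup>2) \<in> borel_measurable borel"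
    unfolding D
    by (intro borel_measurable_power borel_measurable_diff gm
          borel_measurable_continuous_onI continuous_intros)
  then have m: "(\<lambda>x. (discrepancy A x)\<^sup>2) \<in> borel_measurable lborel"
    by simp
  have "\<bar>discrepancy A x\<bar> \<le> real (card A)" if "x \<in> unit_square" for x
  proof -
    have "card (A \<inter> {0..<fst x} \<times> {0..<snd x}) \<le> card A"
      using assms by (intro card_mono) auto
    moreover have "0 \<le> fst x * snd x" "fst x * snd x \<le> 1"
      using that by (simp_all add: mem_Times_iff mult_le_one)
    then have "0 \<le> real (card A) * (fst x * snd x)"
              "real (card A) * (fst x * snd x) \<le> real (card A)"
      by (simp_all add: mult_left_le)
    ultimately show ?thesis
      by (simp add: discrepancy_def case_prod_beta mult.assoc abs_le_iff)
  qed
  then have b: "\<bar>(discrepancy A x)\<^sup>2\<bar> \<le> (real (card A))\<^sup>2" if "x \<in> unit_square" for x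
    using that power_mono[of "\<bar>discrepancy A x\<bar>" "real (card A)" 2] by simp
  have "emeasure lborel unit_square < \<infinity>"
    by (metis bounded_Times bounded_closed_interval emeasure_bounded_finite)
  moreover have "unit_square \<in> sets lborel"
    by (simp add: closed_Times)
  ultimately show ?thesis
    unfolding set_integrable_def using m b
    by (intro integrableI_bounded_set_indicator[where B = "(real (card A))\<^sup>2"]) auto
qed

end

theory Submission
  imports Defs
begin

text \<open>
  Write \<open>N = 2^n\<close>. At grid points the count of points of the shifted set with height below the bit
  reversal of \<open>E\<close> splits, over the digits \<open>r\<close> of \<open>E\<close> equal to one, into counts of
  residue classes modulo \<open>2^(r+1)\<close>. Hence the discrepancy there is a sum over \<open>r\<close> of a sawtooth
  depending on the horizontal position \<open>T\<close> minus the same sawtooth at \<open>T = 0\<close>. Functions of period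
  \<open>2^(r+1)\<close> whose sums over the residue classes of smaller powers of two stay bounded
  have correlations decaying like \<open>2^(-|q-r|)\<close>, so that the mean square of a sum of \<open>n\<close> of them is
  \<open>O(n)\<close>. This applies in \<open>T\<close> for fixed \<open>E\<close>, and in \<open>E\<close> at \<open>T = 0\<close> after subtracting from each
  summand its mean \<open>(\<parallel>k/2^(r+1)\<parallel> - 1/4)/2\<close>, where \<open>\<parallel>\<cdot>\<parallel>\<close> is the distance to the nearest integer.
  On the two periodic blocks of digits \<open>k/2^(r+1)\<close> is close modulo 1 to \<open>2^t/9\<close> and to \<open>2^t/17\<close>.
  There \<open>\<parallel>\<cdot>\<parallel>\<close> averages to \<open>7/27 = 1/4 + 1/108\<close> and to \<open>15/68 = 1/4 - 1/34\<close>, so the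
  ratio \<open>54/17\<close> makes the means cancel up to \<open>O(1)\<close>.
\<close>

section \<open>Bit reversal and the shifted van der Corput set\<close>

text \<open>Only the digits of \<open>x\<close> below \<open>n\<close> enter, so
  \<open>j + k\<close> can later stand for its residue modulo \<open>2 ^ n\<close>.\<close>

primrec bit_reversal :: "nat \<Rightarrow> nat \<Rightarrow> nat" where
  "bit_reversal 0 x = 0"
| "bit_reversal (Suc n) x = 2 * bit_reversal n x + of_bool (bit x n)"

lemma bit_reversal_less: "bit_reversal n x < 2 ^ n"
  by (induction n) auto

lemma bit_reversal_take_bit:
  "n \<le> m \<Longrightarrow> bit_reversal n (take_bit m x) = bit_reversal n x"
  by (induction n) (auto simp: bit_take_bit_iff)

lemma bit_reversal_eq_iff:
  "bit_reversal n x = bit_reversal n y \<longleftrightarrow> take_bit n x = take_bit n y"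
proof (induction n)
  case (Suc n)
  have "bit_reversal (Suc n) x = bit_reversal (Suc n) y \<longleftrightarrow>
      bit_reversal n x = bit_reversal n y \<and> (bit x n \<longleftrightarrow> bit y n)"
    by (cases "bit x n"; cases "bit y n"; simp; presburger)
  also have "\<dots> \<longleftrightarrow> take_bit n x = take_bit n y \<and> (bit x n \<longleftrightarrow> bit y n)"
    by (simp only: Suc.IH)
  also have "\<dots> \<longleftrightarrow> take_bit (Suc n) x = take_bit (Suc n) y"
  proof
    assume eq: "take_bit (Suc n) x = take_bit (Suc n) y"
    have "take_bit n (take_bit (Suc n) x) = take_bit n (take_bit (Suc n) y)"
         "bit (take_bit (Suc n) x) n = bit (take_bit (Suc n) y) n"
      by (simp_all only: eq)
    then show "take_bit n x = take_bit n y \<and> (bit x n \<longleftrightarrow> bit y n)"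
      by (simp add: bit_take_bit_iff)
  qed (simp add: take_bit_Suc_from_most)
  finally show ?case .
qed auto

lemma take_bit_Suc_eq_take_bit_iff:
  fixes x y :: nat
  shows "take_bit (Suc n) x = take_bit n y \<longleftrightarrow> take_bit n x = take_bit n y \<and> \<not> bit x n"
proof -
  have "2 ^ n + take_bit n x \<noteq> take_bit n y"
    using take_bit_nat_less_exp[of n y] by linarith
  then show ?thesis
    by (auto simp: take_bit_Suc_from_most)
qed

lemma of_bool_disj_disjoint:
  "\<not> (P \<and> Q) \<Longrightarrow> of_bool (P \<or> Q) = (of_bool P + of_bool Q :: 'a :: semiring_1)"
  by auto

text \<open>Reversal makes digit 0 the most significant, so the lowest digit \<open>r\<close> where
  \<open>x\<close> and \<open>y\<close> differ decides, and there \<open>y\<close> must have 1. The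
  equation between the \<open>take_bit\<close> terms encodes agreement below \<open>r\<close>
  together with digit \<open>r\<close> of \<open>x\<close> being 0. At most one \<open>r\<close>
  qualifies, so the indicator is a plain sum.\<close>

lemma bit_reversal_less_iff:
  "of_bool (bit_reversal n x < bit_reversal n y) =
     (\<Sum>r<n. of_bool (bit y r \<and> take_bit (Suc r) x = take_bit r y) :: real)"
proof (induction n)
  case (Suc n)
  have "bit_reversal (Suc n) x < bit_reversal (Suc n) y \<longleftrightarrow>
      bit_reversal n x < bit_reversal n y \<or>
      bit_reversal n x = bit_reversal n y \<and> bit y n \<and> \<not> bit x n"
    by (auto simp: of_bool_def)
  also have "\<dots> \<longleftrightarrow> bit_reversal n x < bit_reversal n y \<or>
      bit y n \<and> take_bit (Suc n) x = take_bit n y"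
    by (auto simp: take_bit_Suc_eq_take_bit_iff bit_reversal_eq_iff)
  finally have iff: "bit_reversal (Suc n) x < bit_reversal (Suc n) y \<longleftrightarrow>
      bit_reversal n x < bit_reversal n y \<or> bit y n \<and> take_bit (Suc n) x = take_bit n y" .
  have disjoint: "\<not> (bit_reversal n x < bit_reversal n y \<and>
      bit y n \<and> take_bit (Suc n) x = take_bit n y)"
    by (auto simp: take_bit_Suc_eq_take_bit_iff bit_reversal_eq_iff[symmetric])
  have "of_bool (bit_reversal (Suc n) x < bit_reversal (Suc n) y) =
      (of_bool (bit_reversal n x < bit_reversal n y)
       + of_bool (bit y n \<and> take_bit (Suc n) x = take_bit n y) :: real)"
    unfolding iff by (rule of_bool_disj_disjoint[OF disjoint])
  then show ?case
    by (simp only: Suc.IH sum.lessThan_Suc)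
qed auto

lemma bit_reversal_div_power:
  "real (bit_reversal n x) / 2 ^ n = (\<Sum>r<n. of_bool (bit x r) / 2 ^ Suc r)"
proof (induction n)
  case (Suc n)
  have "real (bit_reversal (Suc n) x) / 2 ^ Suc n =
      real (bit_reversal n x) / 2 ^ n + of_bool (bit x n) / 2 ^ Suc n"
    by (simp add: add_divide_distrib)
  then show ?case
    by (simp only: Suc.IH sum.lessThan_Suc)
qed simp

lemma bij_betw_bit_reversal: "bij_betw (bit_reversal n) {..<2 ^ n} {..<2 ^ n}"
proof -
  have "inj_on (bit_reversal n) {..<2 ^ n}"
    by (rule inj_onI) (simp add: bit_reversal_eq_iff take_bit_nat_eq_self)
  moreover have "bit_reversal n ` {..<2 ^ n} \<subseteq> {..<2 ^ n}"
    by (auto simp: bit_reversal_less)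
  ultimately show ?thesis
    unfolding bij_betw_def by (metis endo_inj_surj finite_lessThan)
qed

section \<open>Points of the set indexed by integers\<close>

lemma binary_nat_Cons: "binary_nat (c # b) = c * 2 ^ length b + binary_nat b"
  by (simp add: binary_nat_def horner_sum_append)

lemma binary_nat_append: "binary_nat (a @ b) = binary_nat a * 2 ^ length b + binary_nat b"
  by (simp add: binary_nat_def horner_sum_append)

lemma binary_nat_Nil: "binary_nat [] = 0"
  by (simp add: binary_nat_def)

lemma binary_fraction_snoc:
  "binary_fraction (a @ [c]) = binary_fraction a + real c / 2 ^ Suc (length a)"
  by (simp add: binary_fraction_def nth_append)

lemma binary_fraction_eq: "binary_fraction a = real (binary_nat a) / 2 ^ length a"
proof (induction a rule: rev_induct)
  case (snoc c a)
  show ?case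
    by (simp add: binary_fraction_snoc binary_nat_append binary_nat_Cons binary_nat_Nil
        snoc.IH add_divide_distrib)
qed (simp add: binary_fraction_def binary_nat_Nil)

lemma binary_nat_less: "set a \<subseteq> {0, 1} \<Longrightarrow> binary_nat a < 2 ^ length a"
  by (induction a) (auto simp: binary_nat_Cons binary_nat_Nil)

lemma binary_nat_rev:
  "set a \<subseteq> {0, 1} \<Longrightarrow> binary_nat (rev a) = bit_reversal (length a) (binary_nat a)"
proof (induction a)
  case (Cons c a)
  have c: "c = 0 \<or> c = 1" and a: "binary_nat a < 2 ^ length a"
    using Cons.prems binary_nat_less[of a] by auto
  have t: "take_bit (length a) (binary_nat (c # a)) = binary_nat a"
    using a by (simp add: binary_nat_Cons take_bit_eq_mod)
  have "bit (binary_nat (c # a)) (length a) \<longleftrightarrow> c = 1"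
    using a c by (auto simp: binary_nat_Cons bit_iff_odd)
  then have b: "of_bool (bit (binary_nat (c # a)) (length a)) = c"
    using c by auto
  have "bit_reversal (length a) (binary_nat (c # a)) = bit_reversal (length a) (binary_nat a)"
    using bit_reversal_take_bit[of "length a" "length a" "binary_nat (c # a)"] t by simp
  then show ?case
    using Cons b by (simp add: binary_nat_append binary_nat_Cons binary_nat_Nil)
qed (simp add: binary_nat_Nil)

lemma binary_nat_image:
  "binary_nat ` {a. length a = n \<and> set a \<subseteq> {0, 1}} = {..<2 ^ n}"
proof (intro equalityI subsetI)
  fix x :: nat assume "x \<in> {..<2 ^ n}"
  then show "x \<in> binary_nat ` {a. length a = n \<and> set a \<subseteq> {0, 1}}"
  proof (induction n arbitrary: x)
    case (Suc n)
    have "x mod 2 ^ n \<in> {..<2 ^ n}"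
      by simp
    from Suc.IH[OF this] obtain a
      where a: "length a = n" "set a \<subseteq> {0, 1}" "binary_nat a = x mod 2 ^ n"
      by auto
    have "x div 2 ^ n < 2"
      using Suc.prems by (simp add: less_mult_imp_div_less)
    then have "x div 2 ^ n \<in> {0, 1}"
      by (metis insertI1 insertI2 less_2_cases One_nat_def)
    then have mem: "x div 2 ^ n # a \<in> {a. length a = Suc n \<and> set a \<subseteq> {0, 1}}"
      using a(1,2) by simp
    have "x = binary_nat (x div 2 ^ n # a)"
      by (simp only: binary_nat_Cons a div_mult_mod_eq)
    then show ?case
      using mem by (rule image_eqI)
  qed (auto simp: binary_nat_Nil)
qed (auto simp: binary_nat_less)

text \<open>The extra final digit 1 becomes the 1/2: every point is the centre of a grid
  cell.\<close>

lemma van_der_corput_set_eq: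
  "van_der_corput_set n =
     (\<lambda>x. ((real x + 1/2) / 2 ^ n, (real (bit_reversal n x) + 1/2) / 2 ^ n)) ` {..<2 ^ n}"
proof -
  have p: "(binary_fraction (a @ [1]), binary_fraction (rev a @ [1])) =
      ((real (binary_nat a) + 1/2) / 2 ^ n, (real (bit_reversal n (binary_nat a)) + 1/2) / 2 ^ n)"
    if "length a = n" "set a \<subseteq> {0, 1}" for a
    using that
    by (simp only: binary_fraction_snoc)
      (simp add: binary_fraction_eq binary_nat_rev add_divide_distrib)
  have "van_der_corput_set n =
      (\<lambda>a. (binary_fraction (a @ [1]), binary_fraction (rev a @ [1])))
        ` {a. length a = n \<and> set a \<subseteq> {0, 1}}"
    by (auto simp: van_der_corput_set_def)
  also have "\<dots> = (\<lambda>a. ((real (binary_nat a) + 1/2) / 2 ^ n,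
      (real (bit_reversal n (binary_nat a)) + 1/2) / 2 ^ n))
        ` {a. length a = n \<and> set a \<subseteq> {0, 1}}"
    by (intro image_cong refl) (use p in blast)
  also have "\<dots> = (\<lambda>x. ((real x + 1/2) / 2 ^ n, (real (bit_reversal n x) + 1/2) / 2 ^ n))
      ` {..<2 ^ n}"
    by (simp only: binary_nat_image[symmetric] image_image)
  finally show ?thesis .
qed

lemma image_add_mod:
  fixes k N :: nat
  assumes "N > 0"
  shows "(\<lambda>j. (j + k) mod N) ` {..<N} = {..<N}"
proof (intro equalityI subsetI)
  fix x assume "x \<in> {..<N}"
  \<comment> \<open>\<open>(N - 1) * k\<close> acts as \<open>-k\<close> modulo \<open>N\<close> and
    avoids truncated subtraction.\<close>
  then have x: "x = ((x + (N - 1) * k) mod N + k) mod N"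
  proof -
    have "x + (N - 1) * k + k = x + N * k"
      using assms by (cases N) auto
    then show ?thesis
      using \<open>x \<in> {..<N}\<close>
      by (simp only: mod_add_left_eq mod_mult_self2 lessThan_iff mod_less)
  qed
  show "x \<in> (\<lambda>j. (j + k) mod N) ` {..<N}"
    by (rule image_eqI[where x = "(x + (N - 1) * k) mod N"]) (rule x, use assms in simp)
qed (use assms in auto)

text \<open>The shift sends horizontal index \<open>x\<close> to \<open>x - k\<close> modulo
  \<open>2 ^ n\<close>. Naming points by the new index \<open>j\<close> moves \<open>k\<close> into
  the height, so the horizontal condition becomes a plain initial segment of
  \<open>j\<close>.\<close>

lemma cyclic_shift_van_der_corput_set:
  "cyclic_shift (1 - real k / 2 ^ n) (van_der_corput_set n) =
     (\<lambda>j. ((real j + 1/2) / 2 ^ n, (real (bit_reversal n (j + k)) + 1/2) / 2 ^ n)) ` {..<2 ^ n}"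
proof -
  have f: "frac ((real ((j + k) mod 2 ^ n) + 1/2) / 2 ^ n + (1 - real k / 2 ^ n))
      = (real j + 1/2) / 2 ^ n" if "j < 2 ^ n" for j
  proof -
    have "real (j + k) = real (2 ^ n * ((j + k) div 2 ^ n) + (j + k) mod 2 ^ n)"
      by (simp only: mult_div_mod_eq)
    then have e: "real ((j + k) mod 2 ^ n) = real j + real k - 2 ^ n * real ((j + k) div 2 ^ n)"
      by (simp only: of_nat_add of_nat_mult of_nat_power of_nat_numeral)
    have "real j + 1/2 < 2 ^ n"
    proof -
      have "real (j + 1) \<le> real (2 ^ n)"
        using that by (intro of_nat_mono) simp
      then show ?thesis by simp
    qed
    then have "(real j + 1/2) / 2 ^ n < 1"
      by simp
    moreover
    have "(real ((j + k) mod 2 ^ n) + 1/2) / 2 ^ n + (1 - real k / 2 ^ n)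
        = (real j + 1/2) / 2 ^ n + of_int (1 - int ((j + k) div 2 ^ n))"
      unfolding e by (simp add: field_simps)
    then have "(real ((j + k) mod 2 ^ n) + 1/2) / 2 ^ n + (1 - real k / 2 ^ n)
        - (real j + 1/2) / 2 ^ n \<in> \<int>"
      by (metis Ints_of_int add_diff_cancel_left')
    ultimately show ?thesis
      by (simp only: frac_unique_iff) simp
  qed
  have "cyclic_shift (1 - real k / 2 ^ n) (van_der_corput_set n) =
      (\<lambda>x. (frac ((real x + 1/2) / 2 ^ n + (1 - real k / 2 ^ n)),
           (real (bit_reversal n x) + 1/2) / 2 ^ n)) ` (\<lambda>j. (j + k) mod 2 ^ n) ` {..<2 ^ n}"
    by (simp only: cyclic_shift_def van_der_corput_set_eq image_image[of "\<lambda>(x, y). _ x y"]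
      image_add_mod[of "2 ^ n"] zero_less_power zero_less_numeral prod.case)
  also have "\<dots> = (\<lambda>j. ((real j + 1/2) / 2 ^ n, (real (bit_reversal n (j + k)) + 1/2) / 2 ^ n))
      ` {..<2 ^ n}"
    unfolding image_image
    using f bit_reversal_take_bit[of n n] by (intro image_cong) (auto simp: take_bit_eq_mod)
  finally show ?thesis .
qed

section \<open>Quasi-orthogonality of sawtooth functions\<close>

lemma sum_lessThan_mult:
  fixes f :: "nat \<Rightarrow> 'a :: comm_monoid_add"
  shows "(\<Sum>x<a * b. f x) = (\<Sum>e<a. \<Sum>m<b. f (e + a * m))"
proof -
  have "sum f {m * a..<m * a + a} = (\<Sum>e<a. f (e + a * m))" for m
    using sum.shift_bounds_nat_ivl[of f 0 "m * a" a] by (simp add: lessThan_atLeast0 ac_simps)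
  then have "(\<Sum>x<a * b. f x) = (\<Sum>m<b. \<Sum>e<a. f (e + a * m))"
    using sum.nat_group[of f a b] by (simp add: mult.commute)
  then show ?thesis
    by (simp only: sum.swap[of _ "{..<a}"])
qed

lemma sum_half_powers_le: "(\<Sum>q<m. (1/2 :: real) ^ (m - q)) \<le> 1"
proof (induction m)
  case (Suc m)
  have "(\<Sum>q<m. (1/2 :: real) ^ (Suc m - q)) = (\<Sum>q<m. (1/2) ^ (m - q)) / 2"
    unfolding sum_divide_distrib by (intro sum.cong) (auto simp: Suc_diff_le)
  with Suc.IH show ?case by simp
qed simp

text \<open>The slower function \<open>g\<close> is summed first: on a residue class modulo
  \<open>2 ^ Suc q\<close> the factor \<open>f\<close> is constant, and \<open>g\<close> contributes
  at most \<open>C\<close> per period. There are \<open>2 ^ Suc q\<close> classes and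
  \<open>2 ^ (n - Suc r)\<close> periods, whose product is \<open>2 ^ n\<close> times the stated
  decay.\<close>

lemma periodic_product_sum_le:
  fixes f g :: "nat \<Rightarrow> real"
  assumes "q < r" "r < n"
    and f: "\<And>x. f (x mod 2 ^ Suc q) = f x" "\<And>x. \<bar>f x\<bar> \<le> 1"
    and g: "\<And>x. g (x mod 2 ^ Suc r) = g x"
    and cls: "\<And>e. e < 2 ^ Suc q \<Longrightarrow> \<bar>\<Sum>m<2 ^ (r - q). g (e + 2 ^ Suc q * m)\<bar> \<le> C"
  shows "\<bar>\<Sum>x<2 ^ n. f x * g x\<bar> \<le> C * 2 ^ n * (1/2) ^ (r - q)"
proof -
  have f': "f (e + 2 ^ Suc q * m) = f e" for e m
    by (metis f(1) mod_mult_self2)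
  have g': "g (e + 2 ^ Suc r * m) = g e" for e m
    by (metis g mod_mult_self2)
  have qr: "2 ^ Suc r = 2 ^ Suc q * (2 :: nat) ^ (r - q)" and rn: "2 ^ n = 2 ^ Suc r * (2 :: nat) ^ (n - Suc r)"
    using assms(1,2) by (simp_all flip: power_add power_Suc)
  have f'': "f (e + 2 ^ Suc r * m) = f e" for e m
    unfolding qr mult.assoc by (rule f')
  have "(\<Sum>x<2 ^ n. f x * g x) = 2 ^ (n - Suc r) * (\<Sum>x<2 ^ Suc r. f x * g x)"
    unfolding rn sum_lessThan_mult f'' g' by (simp only: sum_constant card_lessThan) (simp add: sum_distrib_left)
  also have "(\<Sum>x<2 ^ Suc r. f x * g x)
      = (\<Sum>e<2 ^ Suc q. f e * (\<Sum>m<2 ^ (r - q). g (e + 2 ^ Suc q * m)))"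
    unfolding qr sum_lessThan_mult f' by (simp only: sum_distrib_left)
  finally have eq: "(\<Sum>x<2 ^ n. f x * g x) = 2 ^ (n - Suc r) *
      (\<Sum>e<2 ^ Suc q. f e * (\<Sum>m<2 ^ (r - q). g (e + 2 ^ Suc q * m)))" .
  have "\<bar>\<Sum>e<2 ^ Suc q. f e * (\<Sum>m<2 ^ (r - q). g (e + 2 ^ Suc q * m))\<bar>
      \<le> (\<Sum>e<(2::nat) ^ Suc q. C)"
  proof (rule sum_abs[THEN order_trans], rule sum_mono)
    fix e :: nat assume "e \<in> {..<2 ^ Suc q}"
    then have "\<bar>\<Sum>m<2 ^ (r - q). g (e + 2 ^ Suc q * m)\<bar> \<le> C"
      by (intro cls) simp
    then have "\<bar>f e\<bar> * \<bar>\<Sum>m<2 ^ (r - q). g (e + 2 ^ Suc q * m)\<bar> \<le> 1 * C"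
      by (intro mult_mono f(2)) auto
    then show "\<bar>f e * (\<Sum>m<2 ^ (r - q). g (e + 2 ^ Suc q * m))\<bar> \<le> C"
      by (simp only: abs_mult mult_1)
  qed
  then have "\<bar>\<Sum>x<2 ^ n. f x * g x\<bar> \<le> 2 ^ (n - Suc r) * (2 ^ Suc q * C)"
    unfolding eq abs_mult by (intro mult_mono) (simp_all del: power_Suc)
  also have "\<dots> = C * 2 ^ n * (1/2) ^ (r - q)"
  proof -
    have "(2::real) ^ n = 2 ^ (n - Suc r) * 2 ^ Suc q * 2 ^ (r - q)"
      using assms(1,2) by (simp flip: power_add power_Suc)
    then show ?thesis
      by (simp add: power_divide)
  qed
  finally show ?thesis .
qed

lemma sum_power2_add:
  fixes s v :: "'a \<Rightarrow> real"
  shows "(\<Sum>x\<in>A. (s x + v x)\<^sup>2) = (\<Sum>x\<in>A. (s x)\<^sup>2) + 2 * (\<Sum>x\<in>A. s x * v x) + (\<Sum>x\<in>A. (v x)\<^sup>2)"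
  by (simp add: power2_sum sum.distrib sum_distrib_left mult.assoc add_ac)

text \<open>Induction on the number of summands with the range of \<open>x\<close> fixed. A new
  summand adds at most \<open>2 ^ n\<close> from its own square and, the decays forming a geometric
  series, at most \<open>2 * C * 2 ^ n\<close> from the cross terms.\<close>

lemma quasi_orthogonal_sum_square_le:
  fixes u :: "nat \<Rightarrow> nat \<Rightarrow> real"
  assumes per: "\<And>r x. u r (x mod 2 ^ Suc r) = u r x"
    and bd: "\<And>r x. \<bar>u r x\<bar> \<le> 1"
    and cls: "\<And>q r e. q < r \<Longrightarrow> e < 2 ^ Suc q \<Longrightarrow>
       \<bar>\<Sum>m<2 ^ (r - q). u r (e + 2 ^ Suc q * m)\<bar> \<le> C"
    and "C \<ge> 0"
  shows "(\<Sum>x<2 ^ n. (\<Sum>r<n. u r x)\<^sup>2) \<le> (2 * C + 1) * real n * 2 ^ n"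
proof -
  have "(\<Sum>x<2 ^ n. (\<Sum>r<m. u r x)\<^sup>2) \<le> (2 * C + 1) * real m * 2 ^ n" if "m \<le> n" for m
    using that
  proof (induction m)
    case (Suc m)
    have "(\<Sum>x<2 ^ n. (\<Sum>q<m. u q x) * u m x) = (\<Sum>q<m. \<Sum>x<2 ^ n. u q x * u m x)"
      by (simp only: sum_distrib_right) (rule sum.swap)
    also have "\<dots> \<le> (\<Sum>q<m. C * 2 ^ n * (1/2) ^ (m - q))"
    proof (rule sum_mono)
      fix q assume "q \<in> {..<m}"
      then have "\<bar>\<Sum>x<2 ^ n. u q x * u m x\<bar> \<le> C * 2 ^ n * (1/2) ^ (m - q)"
        using Suc.prems by (intro periodic_product_sum_le per bd cls) auto
      then show "(\<Sum>x<2 ^ n. u q x * u m x) \<le> C * 2 ^ n * (1/2) ^ (m - q)"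
        by linarith
    qed
    also have "\<dots> = C * 2 ^ n * (\<Sum>q<m. (1/2) ^ (m - q))"
      by (simp only: sum_distrib_left)
    also have "\<dots> \<le> C * 2 ^ n * 1"
      using sum_half_powers_le \<open>C \<ge> 0\<close> by (intro mult_left_mono) auto
    finally have cross: "(\<Sum>x<2 ^ n. (\<Sum>q<m. u q x) * u m x) \<le> C * 2 ^ n"
      by simp
    have "(\<Sum>x<2 ^ n. (u m x)\<^sup>2) \<le> (\<Sum>x<(2::nat) ^ n. 1)"
      using bd by (intro sum_mono) (simp add: abs_square_le_1)
    then have diag: "(\<Sum>x<2 ^ n. (u m x)\<^sup>2) \<le> 2 ^ n"
      by simp
    have "(\<Sum>x<2 ^ n. (\<Sum>r<Suc m. u r x)\<^sup>2) = (\<Sum>x<2 ^ n. (\<Sum>r<m. u r x)\<^sup>2)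
        + 2 * (\<Sum>x<2 ^ n. (\<Sum>q<m. u q x) * u m x) + (\<Sum>x<2 ^ n. (u m x)\<^sup>2)"
      by (simp only: sum.lessThan_Suc sum_power2_add)
    also have "\<dots> \<le> (2 * C + 1) * real m * 2 ^ n + 2 * (C * 2 ^ n) + 2 ^ n"
      using Suc cross diag by (intro add_mono mult_left_mono) auto
    finally show ?case
      by (simp add: algebra_simps)
  qed simp
  then show ?thesis by simp
qed

section \<open>Sawtooth functions and counts in residue classes\<close>

definition sawtooth :: "nat \<Rightarrow> int \<Rightarrow> real" where
  "sawtooth r x = real_of_int (x mod 2 ^ Suc r) / 2 ^ Suc r - 1 / 2"

lemma abs_sawtooth_le: "\<bar>sawtooth r x\<bar> \<le> 1 / 2"
proof -
  have "0 \<le> x mod 2 ^ Suc r" "x mod 2 ^ Suc r < 2 ^ Suc r"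
    by simp_all
  then have "0 \<le> real_of_int (x mod 2 ^ Suc r)" "real_of_int (x mod 2 ^ Suc r) < real_of_int (2 ^ Suc r)"
    by (simp_all only: of_int_0_le_iff of_int_less_iff)
  then have "0 \<le> real_of_int (x mod 2 ^ Suc r) / 2 ^ Suc r" "real_of_int (x mod 2 ^ Suc r) / 2 ^ Suc r \<le> 1"
    by simp_all
  then show ?thesis
    unfolding sawtooth_def by linarith
qed

lemma sawtooth_cong: "x mod 2 ^ Suc r = y mod 2 ^ Suc r \<Longrightarrow> sawtooth r x = sawtooth r y"
  by (simp only: sawtooth_def)

text \<open>Raising \<open>T\<close> by one lowers the first sawtooth by
  \<open>1 / 2 ^ Suc r\<close>, which cancels the growth of the linear term. The exception is an
  argument divisible by the period, where the sawtooth also jumps up by 1; this happens exactly when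
  \<open>j = T\<close> is counted.\<close>

lemma count_residue_class:
  assumes "e < 2 ^ Suc r"
  shows "(\<Sum>j<T. of_bool ((j + k) mod 2 ^ Suc r = e)) =
     real T / 2 ^ Suc r + sawtooth r (int e - int k - int T) - sawtooth r (int e - int k)"
proof (induction T)
  case (Suc T)
  define M :: int where "M = 2 ^ Suc r"
  define x where "x = int e - int k - int T"
  have M: "M > 1"
    using one_less_power[of "2 :: int" "Suc r"] by (simp only: M_def)
  have "(T + k) mod 2 ^ Suc r = e \<longleftrightarrow> int ((T + k) mod 2 ^ Suc r) = int e"
    by (simp only: of_nat_eq_iff)
  also have "\<dots> \<longleftrightarrow> (int T + int k) mod M = int e mod M"
  proof -
    have "int e < M"
      using assms by (metis M_def of_nat_less_iff of_nat_numeral of_nat_power)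
    then have "int e mod M = int e"
      by simp
    then show ?thesis
      by (simp only: zmod_int of_nat_add of_nat_power of_nat_numeral M_def)
  qed
  also have "\<dots> \<longleftrightarrow> x mod M = 0"
    unfolding x_def by (smt (verit) mod_eq_dvd_iff dvd_eq_mod_eq_0)
  finally have iff: "(T + k) mod 2 ^ Suc r = e \<longleftrightarrow> x mod M = 0" .
  have "(x - 1) mod M = (x mod M - 1) mod M"
    by (simp add: mod_diff_left_eq)
  also have "\<dots> = (if x mod M = 0 then M - 1 else x mod M - 1)"
    using M by (auto simp: zmod_minus1 intro!: mod_pos_pos_trivial)
       (smt (verit) pos_mod_bound pos_mod_sign)+
  finally have step: "sawtooth r (x - 1) = sawtooth r x - 1 / 2 ^ Suc r + of_bool (x mod M = 0)"
    unfolding sawtooth_def M_def[symmetric] by (simp add: M_def field_simps)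
  have shift: "int e - int k - int (Suc T) = x - 1"
    by (simp add: x_def)
  show ?case
    by (simp only: sum.lessThan_Suc Suc.IH iff shift step x_def[symmetric])
      (simp add: add_divide_distrib)
qed simp

text \<open>The map from \<open>m\<close> to \<open>(y - m) mod M\<close> is its own inverse on
  \<open>{..<M}\<close>, hence the same witness twice.\<close>

lemma sum_diff_mod_period:
  fixes y :: int
  assumes "M > 0"
  shows "(\<Sum>m<M. (y - int m) mod int M) = (\<Sum>m<M. int m)"
proof (rule sum.reindex_bij_witness[of _ "\<lambda>m. nat ((y - int m) mod int M)" "\<lambda>m. nat ((y - int m) mod int M)"])
qed (use assms in \<open>auto simp: mod_diff_right_eq nat_less_iff\<close>)

lemma sum_real_lessThan: "(\<Sum>m<M. real m) = real M * (real M - 1) / 2"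
  by (induction M) (simp_all add: algebra_simps add_divide_distrib)

text \<open>Along the progression the remainder modulo \<open>d\<close> is fixed while the quotients
  run once through all residues modulo \<open>M\<close>. The sum is therefore exactly
  \<open>x mod d / d - 1 / 2\<close>; it is bounded, though in general not zero.\<close>

lemma sum_sawtooth_progression:
  assumes "q < r"
  shows "\<bar>\<Sum>m<2 ^ (r - q). sawtooth r (c - int (e + 2 ^ Suc q * m))\<bar> \<le> 1"
proof -
  define d :: int where "d = 2 ^ Suc q"
  define M :: nat where "M = 2 ^ (r - q)"
  define x where "x = c - int e"
  have dM: "2 ^ Suc r = d * int M" and pos: "d > 0" "M > 0"
    using assms by (simp_all add: d_def M_def flip: power_add power_Suc)
  have "(x - d * int m) mod (d * int M) = d * ((x div d - int m) mod int M) + x mod d" for m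
  proof -
    have "(x - d * int m) div d = x div d - int m" "(x - d * int m) mod d = x mod d"
      using pos(1) div_mult_self2[of d x "- int m"] mod_mult_self2[of x d "- int m"]
      by simp_all
    then show ?thesis
      by (simp only: zmod_zmult2_eq[OF of_nat_0_le_iff])
  qed
  moreover have "c - int (e + 2 ^ Suc q * m) = x - d * int m" for m
    by (simp add: x_def d_def)
  ultimately have "(c - int (e + 2 ^ Suc q * m)) mod 2 ^ Suc r =
      d * ((x div d - int m) mod int M) + x mod d" for m
    by (simp only: dM)
  moreover have "(2 :: real) ^ Suc r = d * M"
    by (metis dM of_int_mult of_int_numeral of_int_of_nat_eq of_int_power)
  ultimately have s: "sawtooth r (c - int (e + 2 ^ Suc q * m)) =
      real_of_int (d * ((x div d - int m) mod int M) + x mod d) / (d * M) - 1 / 2" for m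
    by (simp only: sawtooth_def)
  have "(\<Sum>m<M. d * ((x div d - int m) mod int M) + x mod d) =
      d * (\<Sum>m<M. int m) + int M * (x mod d)"
    by (simp add: sum.distrib sum_diff_mod_period pos flip: sum_distrib_left)
  then have "real_of_int (\<Sum>m<M. d * ((x div d - int m) mod int M) + x mod d) =
      d * (\<Sum>m<M. real m) + M * real_of_int (x mod d)"
    by simp
  then have t: "(\<Sum>m<M. real_of_int (d * ((x div d - int m) mod int M) + x mod d)) =
      d * (M * (real M - 1) / 2) + M * real_of_int (x mod d)"
    by (simp only: of_int_sum sum_real_lessThan)
  have "(\<Sum>m<2 ^ (r - q). sawtooth r (c - int (e + 2 ^ Suc q * m))) =
     (d * (M * (real M - 1) / 2) + M * real_of_int (x mod d)) / (d * int M) - real M / 2"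
    unfolding s sum_subtractf M_def[symmetric] sum_divide_distrib[symmetric] t by simp
  also have "\<dots> = x mod d / d - 1 / 2"
    using pos by (simp add: field_simps)
  finally have eq: "(\<Sum>m<2 ^ (r - q). sawtooth r (c - int (e + 2 ^ Suc q * m))) = x mod d / d - 1 / 2" .
  have "0 \<le> x mod d" "x mod d < d"
    using pos by simp_all
  then have "0 \<le> x mod d / d" "x mod d / d < 1"
    using pos by simp_all
  then show ?thesis
    unfolding eq by linarith
qed

section \<open>The mean of the discrepancy\<close>

definition int_dist :: "real \<Rightarrow> real" where
  "int_dist x = min (frac x) (1 - frac x)"

lemma int_dist_le: "int_dist x \<le> \<bar>x - of_int m\<bar>"
proof (cases "m \<le> \<lfloor>x\<rfloor>")
  case True
  then have "real_of_int m \<le> of_int \<lfloor>x\<rfloor>"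
    by (simp only: of_int_le_iff)
  then show ?thesis
    unfolding int_dist_def frac_def by linarith
next
  case False
  then have "\<lfloor>x\<rfloor> + 1 \<le> m"
    by simp
  then have "real_of_int (\<lfloor>x\<rfloor> + 1) \<le> of_int m"
    by (simp only: of_int_le_iff)
  then show ?thesis
    unfolding int_dist_def frac_def by linarith
qed

lemma int_dist_attained: "\<exists>m. int_dist x = \<bar>x - of_int m\<bar>"
proof (cases "frac x \<le> 1 - frac x")
  case True
  then have "int_dist x = \<bar>x - of_int \<lfloor>x\<rfloor>\<bar>"
    unfolding int_dist_def using frac_ge_0[of x] by (simp add: frac_def)
  then show ?thesis ..
next
  case False
  then have "int_dist x = \<bar>x - of_int (\<lfloor>x\<rfloor> + 1)\<bar>"
    unfolding int_dist_def using frac_lt_1[of x] by (simp add: frac_def)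
  then show ?thesis ..
qed

text \<open>Period 1 and the Lipschitz bound in one: the nearest integer of either argument, moved
  by \<open>m\<close>, competes for the other.\<close>

lemma int_dist_diff_le: "\<bar>int_dist (x + of_int m) - int_dist y\<bar> \<le> \<bar>x - y\<bar>"
proof -
  obtain a b where a: "int_dist (x + of_int m) = \<bar>x + of_int m - of_int a\<bar>"
      and b: "int_dist y = \<bar>y - of_int b\<bar>"
    using int_dist_attained by meson
  have "int_dist y \<le> \<bar>y - of_int (a - m)\<bar>" "int_dist (x + of_int m) \<le> \<bar>x + of_int m - of_int (b + m)\<bar>"
    by (rule int_dist_le)+
  then show ?thesis
    unfolding a b of_int_diff of_int_add by linarith
qed

lemma int_dist_bounds: "0 \<le> int_dist x" "int_dist x \<le> 1 / 2"
  using frac_ge_0[of x] frac_lt_1[of x] unfolding int_dist_def by linarith+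

text \<open>The mean over \<open>x\<close> of the \<open>r\<close>-th summand of the discrepancy at \<open>T = 0\<close>, up to \<open>O(2^-r)\<close>.\<close>

definition drift :: "nat \<Rightarrow> nat \<Rightarrow> real" where
  "drift k r = (int_dist (real k / 2 ^ Suc r) - 1 / 4) / 2"

lemma frac_of_nat_div: "frac (real k / real M) = real (k mod M) / real M" if "M > 0"
proof -
  have "real k = real M * real (k div M) + real (k mod M)"
    by (metis mult_div_mod_eq of_nat_add of_nat_mult)
  then have "real k / real M - real (k mod M) / real M = of_int (int (k div M))"
    using that by (simp add: field_simps)
  then have "real k / real M - real (k mod M) / real M \<in> \<int>"
    by (metis Ints_of_int)
  then show ?thesis
    using that by (simp add: frac_unique_iff)
qed

text \<open>The indicator makes the wrap-around of the remainder explicit, so that wraps can be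
  counted along a progression.\<close>

lemma sawtooth_diff:
  assumes "x < 2 ^ Suc r"
  shows "sawtooth r (int x - int k) = (real x - real (k mod 2 ^ Suc r)) / 2 ^ Suc r
    + of_bool (x < k mod 2 ^ Suc r) - 1 / 2"
proof -
  define P where "P = (2 :: nat) ^ Suc r"
  define K where "K = k mod P"
  have K: "K < P" and x: "x < P"
    using assms by (simp_all add: K_def P_def)
  have "(int x - int k) mod int P = (int x - int K) mod int P"
    by (simp add: K_def zmod_int mod_diff_right_eq)
  also have "\<dots> = int x - int K + int P * of_bool (x < K)"
  proof (cases "x < K")
    case True
    have "(int x - int K) mod int P = (int x - int K + int P) mod int P"
      by simp
    also have "\<dots> = int x - int K + int P"
      using True K by (intro mod_pos_pos_trivial) auto
    finally show ?thesis
      using True by simp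
  qed (use x in \<open>auto intro!: mod_pos_pos_trivial\<close>)
  finally have m: "(int x - int k) mod int P = int x - int K + int P * of_bool (x < K)" .
  have "sawtooth r (int x - int k) = real_of_int ((int x - int k) mod int P) / real P - 1 / 2"
    by (simp add: sawtooth_def P_def)
  also have "\<dots> = (real x - real K) / real P + of_bool (x < K) - 1 / 2"
    unfolding m using x by (simp add: add_divide_distrib)
  finally show ?thesis
    by (simp add: P_def K_def)
qed

lemma sum_of_bool_less: "(\<Sum>m<M. of_bool (m < t)) = (real (min M t) :: real)"
  by (induction M) (auto simp: min_def)

lemma sum_of_bool_progression_less:
  fixes d e K M :: nat
  assumes "e < d"
  shows "\<bar>(\<Sum>m<M. of_bool (e + d * m < K)) - min (real K / real d) (real M)\<bar> \<le> 1"
proof -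
  \<comment> \<open>The ceiling of \<open>(K - e) / d\<close>. Truncated subtraction gives
    \<open>t = 0\<close> when \<open>K\<close> is at most \<open>e\<close>, as it should.\<close>
  define t where "t = (K - e + d - 1) div d"
  have "e + d * m < K \<longleftrightarrow> m < t" for m
  proof -
    have "m < t \<longleftrightarrow> Suc m \<le> t"
      by auto
    also have "\<dots> \<longleftrightarrow> Suc m * d \<le> K - e + d - 1"
      unfolding t_def using assms by (intro less_eq_div_iff_mult_less_eq) simp
    also have "\<dots> \<longleftrightarrow> e + d * m < K"
      using assms by (auto simp: mult.commute)
    finally show ?thesis ..
  qed
  then have "(\<Sum>m<M. of_bool (e + d * m < K)) = real (min M t)"
    by (simp only: sum_of_bool_less)
  moreover have "\<bar>real t - real K / real d\<bar> \<le> 1"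
  proof -
    have "t * d \<le> K - e + d - 1" "K - e + d - 1 < t * d + d"
      using assms unfolding t_def
      by (simp_all add: div_times_less_eq_dividend) (metis dividend_less_div_times add.commute gr_implies_not0 gr0I)
    then have "t * d \<le> K + d" "K \<le> t * d + d"
      using assms by linarith+
    then have "real (t * d) \<le> real (K + d)" "real K \<le> real (t * d + d)"
      by (simp_all only: of_nat_le_iff)
    then have "real t * real d \<le> real K + real d" "real K \<le> real t * real d + real d"
      by simp_all
    then show ?thesis
      using assms by (simp add: abs_le_iff field_simps)
  qed
  ultimately show ?thesis
    by (simp add: of_nat_min abs_le_iff min_def)
qed

text \<open>The sum of sawtooth values consists of a linear part and a count of wraps, and the count
  is \<open>min (K / d) M\<close> up to 1. These main terms combine to
  \<open>M * (int_dist (k / 2 ^ Suc r) - 1 / 4)\<close>, which is \<open>2 ^ (r - q)\<close> times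
  \<open>drift k r\<close>, so subtracting the drift leaves a bounded remainder.\<close>

lemma sum_bit_sawtooth_progression:
  assumes "q < r" "e < 2 ^ Suc q"
  shows "\<bar>\<Sum>m<2 ^ (r - q). of_bool (bit (e + 2 ^ Suc q * m) r)
      * sawtooth r (int (take_bit r (e + 2 ^ Suc q * m)) - int k) - drift k r\<bar> \<le> 2"
proof -
  define f where "f x = of_bool (bit x r) * sawtooth r (int (take_bit r x) - int k)" for x
  define d where "d = (2 :: nat) ^ Suc q"
  define M where "M = (2 :: nat) ^ (r - Suc q)"
  define K where "K = k mod 2 ^ Suc r"
  define c :: real where "c = (\<Sum>m<M. of_bool (e + d * m < K))"
  have rd: "2 ^ r = d * M" and M2: "2 ^ (r - q) = M * 2" and pos: "d > 0" "M > 0"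
    using assms(1) by (simp_all add: d_def M_def flip: power_add power_Suc power_Suc2)
  have rd': "(2::real) ^ r = real d * real M"
    by (metis rd of_nat_mult of_nat_numeral of_nat_power)
  have low: "f x = 0" if "x < 2 ^ r" for x
    using that by (simp add: f_def bit_iff_odd)
  have high: "f (x + 2 ^ r) = sawtooth r (int x - int k)" if "x < 2 ^ r" for x
    using that by (simp add: f_def bit_iff_odd take_bit_eq_mod)
  have small: "e + d * m < 2 ^ r" if "m < M" for m
  proof -
    have "e + d * m < d * Suc m"
      using assms(2) by (simp add: d_def)
    also have "\<dots> \<le> d * M"
      using that by (intro mult_le_mono2) simp
    finally show ?thesis
      unfolding rd .
  qed
  \<comment> \<open>The progression below \<open>2 ^ Suc r\<close> is paired with its translate by
    \<open>2 ^ r\<close>; digit \<open>r\<close> is 1 only in the upper member, so the lower one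
    contributes nothing.\<close>
  have "(\<Sum>m<2 ^ (r - q). f (e + d * m)) = (\<Sum>m<M. f (e + d * m) + f (e + d * m + 2 ^ r))"
    unfolding M2 sum_lessThan_mult rd by (simp add: numeral_2_eq_2 algebra_simps)
  also have "\<dots> = (\<Sum>m<M. sawtooth r (int (e + d * m) - int k))"
    by (intro sum.cong refl) (simp only: low high small lessThan_iff add_0)
  also have "\<dots> = (\<Sum>m<M. (real (e + d * m) - real K) / 2 ^ Suc r + of_bool (e + d * m < K) - 1 / 2)"
  proof (intro sum.cong refl)
    fix m assume "m \<in> {..<M}"
    then have "e + d * m < 2 ^ Suc r"
      using small[of m] by simp
    then show "sawtooth r (int (e + d * m) - int k) =
        (real (e + d * m) - real K) / 2 ^ Suc r + of_bool (e + d * m < K) - 1 / 2"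
      unfolding K_def by (rule sawtooth_diff)
  qed
  also have "\<dots> = (M * real e + d * (M * (real M - 1) / 2) - M * real K) / (2 * d * M) + c - M / 2"
    unfolding sum_subtractf sum.distrib sum_divide_distrib[symmetric] c_def[symmetric]
    by (simp add: sum.distrib sum_real_lessThan rd' flip: sum_distrib_left)
  also have "\<dots> = real e / (2 * d) + (real M - 1) / 4 - real K / d / 2 + c - M / 2"
    using pos by (simp add: field_simps)
  finally have s: "(\<Sum>m<2 ^ (r - q). f (e + d * m)) =
      real e / (2 * d) + (real M - 1) / 4 - real K / d / 2 + c - M / 2" .
  have "frac (real k / 2 ^ Suc r) = real K / (2 * d * M)"
    using frac_of_nat_div[of "2 ^ Suc r" k] by (simp add: K_def rd')
  then have "M * int_dist (real k / 2 ^ Suc r) = min (M * (real K / (2 * d * M))) (M * (1 - real K / (2 * d * M)))"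
    by (simp add: int_dist_def min_mult_distrib_left)
  also have "M * (real K / (2 * d * M)) = real K / d / 2"
    using pos by (simp add: field_simps)
  also have "M * (1 - real K / (2 * d * M)) = M - real K / d / 2"
    using pos by (simp add: field_simps)
  \<comment> \<open>Both sides are \<open>K / d / 2\<close> or \<open>M - K / d / 2\<close>,
    according to whether \<open>K / d\<close> is at most \<open>M\<close>. This form exposes the
    wrap count.\<close>
  also have "min (real K / d / 2) (M - real K / d / 2) = min (real K / d) M - real K / d / 2"
    by (simp add: min_def)
  finally have dist: "M * int_dist (real k / 2 ^ Suc r) = min (real K / d) M - real K / d / 2" .
  have "(\<Sum>m<2 ^ (r - q). f (e + d * m) - drift k r) =
      (\<Sum>m<2 ^ (r - q). f (e + d * m)) - (M * int_dist (real k / 2 ^ Suc r) - M / 4)"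
    by (simp only: sum_subtractf M2 sum_constant card_lessThan) (simp add: drift_def field_simps)
  also have "\<dots> = real e / d / 2 - 1 / 4 + (c - min (real K / d) M)"
    unfolding s dist by (simp add: field_simps)
  finally have eq: "(\<Sum>m<2 ^ (r - q). f (e + d * m) - drift k r) =
      real e / d / 2 - 1 / 4 + (c - min (real K / d) M)" .
  have "\<bar>c - min (real K / d) M\<bar> \<le> 1"
    unfolding c_def using assms(2) by (intro sum_of_bool_progression_less) (simp add: d_def)
  moreover have "real e < real d"
    using assms(2) by (simp only: d_def of_nat_less_iff)
  then have "0 \<le> real e / d" "real e / d < 1"
    by simp_all
  moreover have "\<bar>t / 2 - 1 / 4 + z\<bar> \<le> 2" if "\<bar>z\<bar> \<le> 1" "0 \<le> t" "t < 1" for t z :: real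
    using that by linarith
  ultimately have "\<bar>\<Sum>m<2 ^ (r - q). f (e + d * m) - drift k r\<bar> \<le> 2"
    by (simp only: eq)
  then show ?thesis
    by (simp only: f_def d_def)
qed

section \<open>Cancellation of the drift for the chosen shift\<close>

lemma int_dist_add_of_nat: "int_dist (x + real m) = int_dist x"
  using int_dist_diff_le[of x "int m" x] by simp

lemma length_concat_replicate: "length (concat (replicate j b)) = j * length b"
  by (induction j) auto

text \<open>The block is the repeating part of the binary expansion of \<open>1 / c\<close>; putting
  copies side by side telescopes.\<close>

lemma binary_nat_concat_replicate:
  assumes "length b = m" "binary_nat b * c = 2 ^ m - 1"
  shows "binary_nat (concat (replicate j b)) * c = 2 ^ (j * m) - 1"
proof (induction j)
  case (Suc j)
  have pred: "(P - 1) * Q + (Q - 1) = P * Q - 1" if "P \<ge> 1" "Q \<ge> 1" for P Q :: nat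
    using that by (cases P; cases Q) auto
  have "binary_nat (concat (replicate (Suc j) b)) * c
      = binary_nat b * c * 2 ^ (j * m) + binary_nat (concat (replicate j b)) * c"
    using assms(1) by (simp add: binary_nat_append length_concat_replicate algebra_simps)
  also have "\<dots> = 2 ^ m * 2 ^ (j * m) - 1"
    unfolding assms(2) Suc.IH by (intro pred) simp_all
  also have "\<dots> = 2 ^ (Suc j * m) - 1"
    by (simp add: power_add)
  finally show ?case .
qed (simp add: binary_nat_Nil)

text \<open>The block \<open>000111\<close> has value \<open>7 = (2^6 - 1)/9\<close>, the block \<open>00001111\<close> has value \<open>15 = (2^8 - 1)/17\<close>.\<close>

lemma shift_index_eq:
  assumes "6 dvd n1" "8 dvd n2"
  obtains L1 L2 where "shift_index n0 n1 n2 = 2 ^ n1 * L2 + L1 + 1"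
    "9 * L1 = 2 ^ n1 - 1" "17 * L2 = 2 ^ n2 - 1"
proof
  let ?A = "concat (replicate (n1 div 6) [0, 0, 0, 1, 1, 1 :: nat])"
  let ?B = "concat (replicate (n2 div 8) [0, 0, 0, 0, 1, 1, 1, 1 :: nat])"
  have z: "binary_nat (replicate n0 0) = 0"
    by (induction n0) (auto simp: binary_nat_Nil binary_nat_Cons)
  have l: "length ?A = n1"
    using assms(1) by (simp add: length_concat_replicate) presburger
  show "shift_index n0 n1 n2 = 2 ^ n1 * binary_nat ?B + binary_nat ?A + 1"
    by (simp only: shift_index_def binary_nat_append length_append z l mult_zero_left add_0 mult.commute)
  show "9 * binary_nat ?A = 2 ^ n1 - 1"
    using binary_nat_concat_replicate[of "[0, 0, 0, 1, 1, 1]" 6 9 "n1 div 6"] assms(1)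
    by (simp add: binary_nat_Nil binary_nat_Cons mult.commute)
  show "17 * binary_nat ?B = 2 ^ n2 - 1"
    using binary_nat_concat_replicate[of "[0, 0, 0, 0, 1, 1, 1, 1]" 8 17 "n2 div 8"] assms(2)
    by (simp add: binary_nat_Nil binary_nat_Cons mult.commute)
qed

text \<open>\<open>int_dist (2 ^ t / c)\<close> depends only on \<open>2 ^ t mod c\<close>, which
  has period \<open>p\<close> in \<open>t\<close>. For \<open>p = 0\<close> divisibility forces
  \<open>n = 0\<close> and both sides vanish.\<close>

lemma sum_int_dist_periodic:
  assumes "p dvd n" "2 ^ p mod c = (1 :: nat)" "c > 0"
  shows "(\<Sum>t<n. int_dist (2 ^ t / real c)) = real n / real p * (\<Sum>t<p. int_dist (2 ^ t / real c))"
proof -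
  obtain b where n: "n = p * b"
    using assms(1) by blast
  have "int_dist (2 ^ (t + p * m) / real c) = int_dist (2 ^ t / real c)" for t m
  proof -
    have "(2 :: nat) ^ (t + p * m) mod c = 2 ^ t * ((2 ^ p) ^ m mod c) mod c"
      by (simp only: power_add power_mult mod_mult_right_eq)
    also have "(2 ^ p) ^ m mod c = (1 :: nat) mod c"
      by (metis assms(2) power_mod power_one)
    finally have "(2 :: nat) ^ (t + p * m) mod c = 2 ^ t mod c"
      by (simp only: mod_mult_right_eq mult_1_right)
    then have "frac (real (2 ^ (t + p * m)) / real c) = frac (real (2 ^ t) / real c)"
      by (simp only: frac_of_nat_div[OF assms(3)])
    then show ?thesis
      by (simp add: int_dist_def)
  qed
  then have "(\<Sum>t<n. int_dist (2 ^ t / real c)) = real b * (\<Sum>t<p. int_dist (2 ^ t / real c))"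
    unfolding n sum_lessThan_mult by (simp add: sum_distrib_left)
  moreover have "real b = real n / real p" if "p \<noteq> 0"
    using n that by simp
  moreover have "n = 0" if "p = 0"
    using n that by simp
  ultimately show ?thesis
    by (cases "p = 0") simp_all
qed

lemma sum_int_dist_ninth:
  assumes "6 dvd n"
  shows "(\<Sum>t<n. int_dist (2 ^ t / 9)) = 7 / 27 * real n"
proof -
  have "{..<6} = {0, 1, 2, 3, 4, 5 :: nat}"
    by auto
  \<comment> \<open>The residues 1, 2, 4, 8, 7, 5 modulo 9 have distances 1, 2, 4, 1, 2, 4 to the
    nearest multiple of 9.\<close>
  then have period: "(\<Sum>t<6. int_dist (2 ^ t / 9)) = 14 / 9"
    by (simp add: int_dist_def frac_def)
  have "(\<Sum>t<n. int_dist (2 ^ t / real 9)) = real n / real 6 * (\<Sum>t<6. int_dist (2 ^ t / real 9))"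
    using assms by (intro sum_int_dist_periodic) simp_all
  then show ?thesis
    by (simp only: of_nat_numeral period)
qed

lemma sum_int_dist_seventeenth:
  assumes "8 dvd n"
  shows "(\<Sum>t<n. int_dist (2 ^ t / 17)) = 15 / 68 * real n"
proof -
  have "{..<8} = {0, 1, 2, 3, 4, 5, 6, 7 :: nat}"
    by auto
  \<comment> \<open>The residues 1, 2, 4, 8, 16, 15, 13, 9 modulo 17 have distances 1, 2, 4, 8, 1,
    2, 4, 8 to the nearest multiple of 17.\<close>
  then have period: "(\<Sum>t<8. int_dist (2 ^ t / 17)) = 30 / 17"
    by (simp add: int_dist_def frac_def)
  have "(\<Sum>t<n. int_dist (2 ^ t / real 17)) = real n / real 8 * (\<Sum>t<8. int_dist (2 ^ t / real 17))"
    using assms by (intro sum_int_dist_periodic) simp_all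
  then show ?thesis
    by (simp only: of_nat_numeral period)
qed

text \<open>Dividing by growing powers of two meets the powers \<open>2 ^ t\<close> in decreasing
  order, hence the reversed index; the errors form a geometric series.\<close>

lemma sum_diff_half_powers_le:
  fixes f g :: "nat \<Rightarrow> real"
  assumes "\<And>i. i < m \<Longrightarrow> \<bar>f i - g (m - Suc i)\<bar> \<le> (1/2) ^ Suc i"
  shows "\<bar>(\<Sum>i<m. f i) - (\<Sum>t<m. g t)\<bar> \<le> 1"
proof -
  have "(\<Sum>i<m. f i) - (\<Sum>t<m. g t) = (\<Sum>i<m. f i - g (m - Suc i))"
    by (simp add: sum_subtractf sum.nat_diff_reindex)
  also have "\<bar>\<dots>\<bar> \<le> (\<Sum>i<m. (1/2) ^ Suc i)"
    by (rule sum_abs[THEN order_trans], rule sum_mono) (use assms in auto)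
  also have "\<dots> = (\<Sum>i<m. (1/2 :: real) ^ (m - i))"
    using sum.nat_diff_reindex[of "\<lambda>i. (1/2 :: real) ^ (m - i)" m] by (simp add: Suc_diff_Suc)
  also have "\<dots> \<le> 1"
    by (rule sum_half_powers_le)
  finally show ?thesis .
qed

lemma sum_drift_bounded:
  assumes "6 dvd n1" "8 dvd n2" "17 * n1 = 54 * n2" "n0 < 568"
  shows "\<bar>\<Sum>r<n0 + n1 + n2. drift (shift_index n0 n1 n2) r\<bar> \<le> 72"
proof -
  obtain L1 L2 where k: "shift_index n0 n1 n2 = 2 ^ n1 * L2 + L1 + 1"
    and L1: "9 * L1 = 2 ^ n1 - 1" and L2: "17 * L2 = 2 ^ n2 - 1"
    using shift_index_eq[OF assms(1,2)] by blast
  define k where "k = shift_index n0 n1 n2"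
  have kr: "real k = 2 ^ n1 * real L2 + real L1 + 1"
    by (simp add: k_def k)
  have "9 * L1 + 1 = 2 ^ n1" "17 * L2 + 1 = 2 ^ n2"
    using L1 L2 by simp_all
  then have "real (9 * L1 + 1) = real (2 ^ n1)" "real (17 * L2 + 1) = real (2 ^ n2)"
    by (simp_all only:)
  then have L1r: "real L1 = (2 ^ n1 - 1) / 9" and L2r: "real L2 = (2 ^ n2 - 1) / 17"
    by simp_all
  define a where "a r = int_dist (real k / 2 ^ Suc r)" for r
  have A: "\<bar>(\<Sum>i<n1. a i) - (\<Sum>t<n1. int_dist (2 ^ t / 9))\<bar> \<le> 1"
  proof (rule sum_diff_half_powers_le)
    fix i assume i: "i < n1"
    \<comment> \<open>Modulo 1 the upper block \<open>L2\<close> drops out, and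
      \<open>L1 + 1 = (2 ^ n1 + 8) / 9\<close>, which explains the 8/9.\<close>
    define x where "x = 2 ^ (n1 - Suc i) / 9 + (8 / 9) * (1/2 :: real) ^ Suc i"
    have p: "(2::real) ^ n1 = 2 ^ (n1 - Suc i) * 2 ^ Suc i"
      using i by (simp flip: power_add power_Suc)
    have "real k / 2 ^ Suc i = x + real (2 ^ (n1 - Suc i) * L2)"
      unfolding kr L1r x_def p by (simp add: field_simps power_divide)
    then have "a i = int_dist x"
      by (simp only: a_def int_dist_add_of_nat)
    then have "\<bar>a i - int_dist (2 ^ (n1 - Suc i) / 9)\<bar> \<le> \<bar>x - 2 ^ (n1 - Suc i) / 9\<bar>"
      using int_dist_diff_le[of x 0] by simp
    also have "\<dots> \<le> (1/2) ^ Suc i"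
      by (simp add: x_def)
    finally show "\<bar>a i - int_dist (2 ^ (n1 - Suc i) / 9)\<bar> \<le> (1/2) ^ Suc i" .
  qed
  have B: "\<bar>(\<Sum>i<n2. a (n1 + i)) - (\<Sum>t<n2. int_dist (2 ^ t / 17))\<bar> \<le> 1"
  proof (rule sum_diff_half_powers_le)
    fix i assume i: "i < n2"
    \<comment> \<open>The total error at this level, scaled by \<open>2 ^ Suc i\<close>: the lower
      block with the added 1, and the \<open>-1\<close> in
      \<open>17 * L2 = 2 ^ n2 - 1\<close>.\<close>
    define y where "y = (real L1 + 1) / 2 ^ n1 - 1 / 17"
    have aux: "(z - 1) / 9 + 1 \<le> z" if "1 \<le> z" for z :: real
      using that by (simp add: field_simps)
    have "real L1 + 1 \<le> 2 ^ n1"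
      unfolding L1r by (rule aux) (rule two_realpow_ge_one)
    then have "(real L1 + 1) / 2 ^ n1 \<le> 1" "0 \<le> (real L1 + 1) / 2 ^ n1"
      by simp_all
    then have y: "\<bar>y\<bar> \<le> 1"
      unfolding y_def by linarith
    have p: "(2::real) ^ n2 = 2 ^ (n2 - Suc i) * 2 ^ Suc i"
      using i by (simp flip: power_add power_Suc)
    have "real k / 2 ^ Suc (n1 + i) = real L2 / 2 ^ Suc i + (real L1 + 1) / 2 ^ n1 / 2 ^ Suc i"
      unfolding kr by (simp add: power_add add_divide_distrib)
    also have "real L2 / 2 ^ Suc i = 2 ^ (n2 - Suc i) / 17 - 1 / 17 / 2 ^ Suc i"
      unfolding L2r p by (simp add: field_simps)
    finally have "real k / 2 ^ Suc (n1 + i) = 2 ^ (n2 - Suc i) / 17 + y / 2 ^ Suc i"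
      by (simp only: y_def diff_divide_distrib)
    then have "\<bar>a (n1 + i) - int_dist (2 ^ (n2 - Suc i) / 17)\<bar>
        \<le> \<bar>2 ^ (n2 - Suc i) / 17 + y / 2 ^ Suc i - 2 ^ (n2 - Suc i) / 17\<bar>"
      using int_dist_diff_le[of "2 ^ (n2 - Suc i) / 17 + y / 2 ^ Suc i" 0 "2 ^ (n2 - Suc i) / 17"] by (simp add: a_def)
    also have "\<dots> = \<bar>y\<bar> * (1/2) ^ Suc i"
      by (simp add: power_divide)
    also have "\<dots> \<le> (1/2) ^ Suc i"
      using y by simp
    finally show "\<bar>a (n1 + i) - int_dist (2 ^ (n2 - Suc i) / 17)\<bar> \<le> (1/2) ^ Suc i" .
  qed
  \<comment> \<open>No cancellation is sought in the top \<open>n0\<close> digits;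
    \<open>n0 < 568\<close> keeps their contribution bounded.\<close>
  have C: "\<bar>(\<Sum>i<n0. a (n1 + n2 + i)) - n0 / 4\<bar> \<le> n0 / 4"
  proof -
    have "(\<Sum>i<n0. a (n1 + n2 + i)) \<le> (\<Sum>i<n0. 1 / 2)" "(\<Sum>i<n0. 0) \<le> (\<Sum>i<n0. a (n1 + n2 + i))"
      unfolding a_def by (intro sum_mono int_dist_bounds)+
    then have "(\<Sum>i<n0. a (n1 + n2 + i)) \<le> n0 / 2" "0 \<le> (\<Sum>i<n0. a (n1 + n2 + i))"
      by simp_all
    then show ?thesis
      unfolding abs_le_iff by linarith
  qed
  have split: "(\<Sum>i<x + y. f i) = (\<Sum>i<x. f i) + (\<Sum>i<y. f (x + i))" for x y and f :: "nat \<Rightarrow> real"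
    by (induction y) auto
  have "(\<Sum>r<n0 + n1 + n2. drift k r) = ((\<Sum>r<n1 + n2 + n0. a r) - (n1 + n2 + n0) / 4) / 2"
    by (simp add: drift_def a_def sum_subtractf flip: sum_divide_distrib) (simp add: add_ac)
  also have "(\<Sum>r<n1 + n2 + n0. a r) =
      (\<Sum>i<n1. a i) + (\<Sum>i<n2. a (n1 + i)) + (\<Sum>i<n0. a (n1 + n2 + i))"
    by (simp only: split)
  finally have D: "8 * (\<Sum>r<n0 + n1 + n2. drift k r) = 4 * (\<Sum>i<n1. a i) + 4 * (\<Sum>i<n2. a (n1 + i))
      + 4 * (\<Sum>i<n0. a (n1 + n2 + i)) - (real n1 + real n2 + real n0)"
    by (simp add: field_simps)
  have "real (17 * n1) = real (54 * n2)"
    by (simp only: assms(3))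
  then have n12: "real n1 = 54 / 17 * real n2"
    by simp
  have "real n0 \<le> 568"
    using assms(4) by simp
  \<comment> \<open>In \<open>D\<close> the main terms are \<open>n1 / 27\<close> and
    \<open>- 2 * n2 / 17\<close>, which cancel by \<open>n12\<close>. The errors are 4 from
    \<open>A\<close>, 4 from \<open>B\<close> and at most 568 from \<open>C\<close>, and 576 = 8 *
    72.\<close>
  then have "\<bar>\<Sum>r<n0 + n1 + n2. drift k r\<bar> \<le> 72"
    using A B C D unfolding sum_int_dist_ninth[OF assms(1)] sum_int_dist_seventeenth[OF assms(2)] n12
    by linarith
  then show ?thesis
    by (simp only: k_def)
qed

section \<open>The mean square of the discrepancy\<close>

text \<open>The discrepancy at the cell corner \<open>(T / 2 ^ n, V / 2 ^ n)\<close>, in integers: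
  as points are cell centres, their half-cell offsets disappear from the strict
  inequalities.\<close>

definition grid_discrepancy :: "nat \<Rightarrow> nat \<Rightarrow> nat \<Rightarrow> nat \<Rightarrow> real" where
  "grid_discrepancy n k T V =
     real (card {j. j < T \<and> bit_reversal n (j + k) < V}) - real T * real V / 2 ^ n"

text \<open>Each digit 1 of \<open>E\<close> contributes the count of one residue class. The linear
  parts of these counts add up to the volume term, leaving only sawtooth values.\<close>

lemma grid_discrepancy_bit_reversal:
  "grid_discrepancy n k T (bit_reversal n E) = (\<Sum>r<n. of_bool (bit E r) *
     (sawtooth r (int (take_bit r E) - int k - int T) - sawtooth r (int (take_bit r E) - int k)))"
proof -
  have "real (card {j. j < T \<and> bit_reversal n (j + k) < bit_reversal n E}) =
      (\<Sum>j<T. of_bool (bit_reversal n (j + k) < bit_reversal n E))"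
    by (simp add: lessThan_def Collect_conj_eq)
  also have "\<dots> = (\<Sum>j<T. \<Sum>r<n. of_bool (bit E r) * of_bool ((j + k) mod 2 ^ Suc r = take_bit r E))"
    by (simp only: bit_reversal_less_iff of_bool_conj take_bit_eq_mod[of "Suc _"])
  also have "\<dots> = (\<Sum>r<n. of_bool (bit E r) * (\<Sum>j<T. of_bool ((j + k) mod 2 ^ Suc r = take_bit r E)))"
    by (subst sum.swap) (simp only: sum_distrib_left)
  also have "\<dots> = (\<Sum>r<n. of_bool (bit E r) * (real T / 2 ^ Suc r
      + sawtooth r (int (take_bit r E) - int k - int T) - sawtooth r (int (take_bit r E) - int k)))"
  proof (intro sum.cong refl)
    fix r
    have "take_bit r E < 2 ^ r"
      by (rule take_bit_nat_less_exp)
    also have "(2 :: nat) ^ r \<le> 2 ^ Suc r"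
      by simp
    finally have "take_bit r E < 2 ^ Suc r" .
    then show "of_bool (bit E r) * (\<Sum>j<T. of_bool ((j + k) mod 2 ^ Suc r = take_bit r E)) =
        of_bool (bit E r) * (real T / 2 ^ Suc r
      + sawtooth r (int (take_bit r E) - int k - int T) - sawtooth r (int (take_bit r E) - int k))"
      by (simp only: count_residue_class)
  qed
  finally have count: "real (card {j. j < T \<and> bit_reversal n (j + k) < bit_reversal n E}) = \<dots>" .
  have volume: "real T * real (bit_reversal n E) / 2 ^ n = (\<Sum>r<n. of_bool (bit E r) * (real T / 2 ^ Suc r))"
    using bit_reversal_div_power[of n E]
    by (simp only: times_divide_eq_right[symmetric] sum_distrib_left) (simp add: mult.commute)
  show ?thesis
    unfolding grid_discrepancy_def count volume
    by (simp only: sum_subtractf[symmetric] right_diff_distrib[symmetric]) (simp add: algebra_simps)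
qed

lemma sum_square_sawtooth_in_T:
  fixes c :: "nat \<Rightarrow> int" and b :: "nat \<Rightarrow> bool"
  shows "(\<Sum>T<2 ^ n. (\<Sum>r<n. of_bool (b r) * sawtooth r (c r - int T))\<^sup>2) \<le> 3 * real n * 2 ^ n"
proof -
  have "(\<Sum>T<2 ^ n. (\<Sum>r<n. of_bool (b r) * sawtooth r (c r - int T))\<^sup>2) \<le> (2 * 1 + 1) * real n * 2 ^ n"
  proof (rule quasi_orthogonal_sum_square_le)
    fix r x
    have "(c r - int (x mod 2 ^ Suc r)) mod 2 ^ Suc r = (c r - int x) mod 2 ^ Suc r"
      by (simp only: zmod_int of_nat_power of_nat_numeral mod_diff_right_eq)
    then show "of_bool (b r) * sawtooth r (c r - int (x mod 2 ^ Suc r)) =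
        of_bool (b r) * sawtooth r (c r - int x)"
      by (simp only: sawtooth_cong[of "c r - int (x mod 2 ^ Suc r)"])
    show "\<bar>of_bool (b r) * sawtooth r (c r - int x)\<bar> \<le> 1"
      using abs_sawtooth_le[of r "c r - int x"] by simp
  next
    fix q r e :: nat assume "q < r"
    then show "\<bar>\<Sum>m<2 ^ (r - q). of_bool (b r) * sawtooth r (c r - int (e + 2 ^ Suc q * m))\<bar> \<le> 1"
      using sum_sawtooth_progression[of q r "c r" e]
      by (simp only: sum_distrib_left[symmetric] abs_mult) (simp del: of_nat_add of_nat_mult power_Suc)
  qed simp
  then show ?thesis
    by simp
qed

lemma sum_square_bit_sawtooth:
  "(\<Sum>E<2 ^ n. (\<Sum>r<n. of_bool (bit E r) * sawtooth r (int (take_bit r E) - int k) - drift k r)\<^sup>2)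
     \<le> 5 * real n * 2 ^ n"
proof -
  have "(\<Sum>E<2 ^ n. (\<Sum>r<n. of_bool (bit E r) * sawtooth r (int (take_bit r E) - int k) - drift k r)\<^sup>2)
     \<le> (2 * 2 + 1) * real n * 2 ^ n"
  proof (rule quasi_orthogonal_sum_square_le)
    fix r x :: nat
    have "bit (x mod 2 ^ Suc r) r = bit x r" "take_bit r (x mod 2 ^ Suc r) = take_bit r x"
      by (simp_all only: take_bit_eq_mod[of "Suc r", symmetric])
        (simp_all add: bit_take_bit_iff)
    then show "of_bool (bit (x mod 2 ^ Suc r) r) * sawtooth r (int (take_bit r (x mod 2 ^ Suc r)) - int k) - drift k r =
        of_bool (bit x r) * sawtooth r (int (take_bit r x) - int k) - drift k r"
      by (simp only:)
    have "\<bar>(t - 1 / 4) / 2\<bar> \<le> 1 / 8" if "0 \<le> t" "t \<le> 1 / 2" for t :: real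
      using that unfolding abs_le_iff by (simp add: field_simps)
    then have "\<bar>drift k r\<bar> \<le> 1 / 8"
      unfolding drift_def by (simp only: int_dist_bounds)
    moreover have "\<bar>of_bool (bit x r) * sawtooth r (int (take_bit r x) - int k)\<bar> \<le> 1 / 2"
      using abs_sawtooth_le[of r "int (take_bit r x) - int k"] by simp
    ultimately show "\<bar>of_bool (bit x r) * sawtooth r (int (take_bit r x) - int k) - drift k r\<bar> \<le> 1"
      by linarith
  qed (simp_all only: sum_bit_sawtooth_progression zero_le_numeral)
  then show ?thesis
    by simp
qed

lemma power2_add3_le: "(a + b + c)\<^sup>2 \<le> 3 * (a\<^sup>2 + b\<^sup>2 + c\<^sup>2)" for a b c :: real
proof -
  have "0 \<le> (a - b)\<^sup>2 + (b - c)\<^sup>2 + (a - c)\<^sup>2"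
    by simp
  then show ?thesis
    by (simp add: power2_eq_square algebra_simps)
qed

lemma sum_square_grid_discrepancy:
  assumes "\<bar>\<Sum>r<n. drift k r\<bar> \<le> B"
  shows "(\<Sum>T<2 ^ n. \<Sum>V<2 ^ n. (grid_discrepancy n k T V)\<^sup>2) \<le> 3 * (8 * real n + B\<^sup>2) * (2 ^ n)\<^sup>2"
proof -
  define a where "a E T = (\<Sum>r<n. of_bool (bit E r) * sawtooth r (int (take_bit r E) - int k - int T))" for E T
  define h where "h E = (\<Sum>r<n. of_bool (bit E r) * sawtooth r (int (take_bit r E) - int k) - drift k r)" for E
  define b where "b = (\<Sum>r<n. drift k r)"
  have b2: "b\<^sup>2 \<le> B\<^sup>2"
    using power_mono[OF assms abs_ge_zero, of 2] by (simp add: b_def)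
  \<comment> \<open>\<open>a\<close> is controlled by averaging over \<open>T\<close> for fixed
    \<open>E\<close>, \<open>h\<close> by averaging over \<open>E\<close>, and \<open>b\<close> by
    the assumption on the drift.\<close>
  have G: "grid_discrepancy n k T (bit_reversal n E) = a E T + (- h E) + (- b)" for T E
    unfolding grid_discrepancy_bit_reversal a_def h_def b_def
    by (simp add: sum_subtractf right_diff_distrib)
  have "(\<Sum>T<2 ^ n. \<Sum>V<2 ^ n. (grid_discrepancy n k T V)\<^sup>2) =
      (\<Sum>T<2 ^ n. \<Sum>E<2 ^ n. (grid_discrepancy n k T (bit_reversal n E))\<^sup>2)"
    by (intro sum.cong refl sum.reindex_bij_betw[OF bij_betw_bit_reversal, symmetric])
  also have "\<dots> = (\<Sum>E<2 ^ n. \<Sum>T<2 ^ n. (grid_discrepancy n k T (bit_reversal n E))\<^sup>2)"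
    by (rule sum.swap)
  also have "\<dots> \<le> (\<Sum>E<2 ^ n. \<Sum>T<2 ^ n. 3 * ((a E T)\<^sup>2 + (- h E)\<^sup>2 + (- b)\<^sup>2))"
    unfolding G by (intro sum_mono power2_add3_le)
  also have "\<dots> = (\<Sum>E<2 ^ n. 3 * ((\<Sum>T<2 ^ n. (a E T)\<^sup>2) + 2 ^ n * (h E)\<^sup>2 + 2 ^ n * b\<^sup>2))"
    by (simp add: sum.distrib flip: sum_distrib_left)
  also have "\<dots> \<le> (\<Sum>E<2 ^ n. 3 * (3 * real n * 2 ^ n + 2 ^ n * (h E)\<^sup>2 + 2 ^ n * B\<^sup>2))"
    unfolding a_def by (intro sum_mono mult_left_mono add_mono sum_square_sawtooth_in_T b2) simp_all
  also have "\<dots> = 3 * (3 * real n * 2 ^ n * 2 ^ n + 2 ^ n * (\<Sum>E<2 ^ n. (h E)\<^sup>2) + 2 ^ n * B\<^sup>2 * 2 ^ n)"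
    by (simp add: sum.distrib flip: sum_distrib_left)
  also have "\<dots> \<le> 3 * (3 * real n * 2 ^ n * 2 ^ n + 2 ^ n * (5 * real n * 2 ^ n) + 2 ^ n * B\<^sup>2 * 2 ^ n)"
    unfolding h_def by (intro mult_left_mono add_mono sum_square_bit_sawtooth) simp_all
  also have "\<dots> = 3 * (8 * real n + B\<^sup>2) * (2 ^ n)\<^sup>2"
    by (simp add: power2_eq_square algebra_simps)
  finally show ?thesis .
qed

section \<open>From grid points to the integral over the square\<close>

lemma discrepancy_near_grid:
  fixes n k :: nat
  defines "N \<equiv> (2 :: nat) ^ n"
  defines "A \<equiv> cyclic_shift (1 - real k / 2 ^ n) (van_der_corput_set n)"
  assumes "T < N" "V < N" and x: "real T / N \<le> x" "x \<le> (real T + 1) / N"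
    and y: "real V / N \<le> y" "y \<le> (real V + 1) / N"
  shows "\<bar>discrepancy A (x, y) - grid_discrepancy n k T V\<bar> \<le> 2"
proof -
  define p where "p j = ((real j + 1/2) / N, (real (bit_reversal n (j + k)) + 1/2) / N)" for j
  have A: "A = p ` {..<N}"
    by (simp add: A_def N_def p_def[abs_def] cyclic_shift_van_der_corput_set)
  have N: "real N > 0"
    by (simp add: N_def)
  have inj: "inj p"
    using N by (auto intro!: injI simp: p_def)
  have cardA: "card A = N"
    unfolding A using inj by (simp add: card_image inj_on_subset)
  define S where "S = {j. j < N \<and> real j + 1/2 < N * x \<and> real (bit_reversal n (j + k)) + 1/2 < N * y}"
  define G where "G = {j. j < T \<and> bit_reversal n (j + k) < V}"
  have "A \<inter> {0..<x} \<times> {0..<y} = p ` S"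
    using N by (auto simp: A S_def p_def divide_less_eq mult.commute)
  then have cardS: "card (A \<inter> {0..<x} \<times> {0..<y}) = card S"
    using inj by (simp add: card_image inj_on_subset)
  have xN: "real T \<le> N * x" "N * x \<le> real T + 1" and yN: "real V \<le> N * y" "N * y \<le> real V + 1"
    using x y N by (simp_all add: field_simps)
  have finS: "finite S" and finG: "finite G"
    by (simp_all add: S_def G_def)
  have "G \<subseteq> S"
  proof
    fix j assume "j \<in> G"
    then have "real (j + 1) \<le> real T" "real (bit_reversal n (j + k) + 1) \<le> real V" "j < N"
      using assms(3) by (simp_all only: G_def of_nat_le_iff mem_Collect_eq) auto
    then show "j \<in> S"
      using xN yN by (simp add: S_def)
  qed
  then have "card G \<le> card S"
    by (rule card_mono[OF finS])
  define R where "R = {j. j < N \<and> bit_reversal n (j + k) = V}"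
  have "card R \<le> 1"
  proof -
    have "i = j" if "i \<in> R" "j \<in> R" for i j
    proof -
      have "bit_reversal n (i + k) = bit_reversal n (j + k)"
        using that by (simp add: R_def)
      then have "(i + k) mod N = (j + k) mod N"
        by (simp only: bit_reversal_eq_iff N_def take_bit_eq_mod)
      moreover have "inj_on (\<lambda>j. (j + k) mod N) {..<N}"
        using N by (intro eq_card_imp_inj_on) (simp_all only: image_add_mod finite_lessThan of_nat_0_less_iff)
      ultimately show ?thesis
        using that by (auto simp: R_def dest: inj_onD)
    qed
    then show ?thesis
      by (simp add: card_le_Suc0_iff_eq R_def)
  qed
  \<comment> \<open>Points gained on leaving the corner lie in column \<open>T\<close> or in row
    \<open>V\<close>, and each of these holds at most one point.\<close>
  have "S \<subseteq> G \<union> {T} \<union> R"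
  proof
    fix j assume "j \<in> S"
    then have "real j < real (T + 1)" "real (bit_reversal n (j + k)) < real (V + 1)" "j < N"
      using xN yN by (auto simp: S_def)
    then show "j \<in> G \<union> {T} \<union> R"
      by (simp only: of_nat_less_iff) (auto simp: G_def R_def)
  qed
  then have "card S \<le> card (G \<union> {T} \<union> R)"
    by (rule card_mono[rotated]) (simp add: finG R_def)
  also have "\<dots> \<le> card G + 1 + 1"
    using \<open>card R \<le> 1\<close> card_Un_le[of "G \<union> {T}" R] card_Un_le[of G "{T}"] by simp
  finally have card: "real (card G) \<le> real (card S)" "real (card S) \<le> real (card G) + 2"
    using \<open>card G \<le> card S\<close> by simp_all
  have "real T * real V \<le> (N * x) * (N * y)" "(N * x) * (N * y) \<le> (real T + 1) * (real V + 1)"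
    using xN yN N by (intro mult_mono; simp)+
  \<comment> \<open>The growth is \<open>T + V + 1\<close>, below \<open>2 * N\<close>. Count and
    volume thus both increase by between 0 and 2, so their difference changes by at most 2.\<close>
  moreover have "(real T + 1) * (real V + 1) \<le> real T * real V + 2 * N"
    using assms(3,4) by (simp add: algebra_simps flip: of_nat_add of_nat_le_iff)
  ultimately have "real T * real V / N \<le> N * x * y" "N * x * y \<le> real T * real V / N + 2"
    using N by (simp_all add: field_simps)
  with card show ?thesis
    by (simp add: discrepancy_def cardS cardA grid_discrepancy_def G_def[symmetric] N_def abs_le_iff)
qed

lemma grid_cell_exists:
  fixes x :: real
  assumes "0 \<le> x" "x \<le> 1" "N > 0"
  shows "\<exists>T<N. real T / N \<le> x \<and> x \<le> (real T + 1) / N"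
proof (cases "x = 1")
  case True
  then show ?thesis
    \<comment> \<open>The floor of \<open>N * x\<close> would be \<open>N\<close> here, which is no
      cell index; the closed last cell takes the right endpoint.\<close>
    using assms(3) by (intro exI[of _ "N - 1"]) (simp add: of_nat_diff)
next
  case False
  define T where "T = nat \<lfloor>N * x\<rfloor>"
  have T: "real T \<le> N * x" "N * x < real T + 1"
    using assms by (simp_all add: T_def)
  have "real N * x < real N * 1"
    using False assms by (intro mult_strict_left_mono) auto
  then have "real T < real N"
    using T by simp
  then show ?thesis
    using T assms(3) by (intro exI[of _ T]) (simp add: field_simps)
qed

text \<open>Closed cells overlap along edges, so the step function \<open>g\<close> may count
  several cells there. As \<open>c\<close> is nonnegative, \<open>g\<close> still dominates
  \<open>f\<close> pointwise on the square.\<close>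

lemma integral_unit_square_le_grid_sum:
  fixes f :: "real \<times> real \<Rightarrow> real" and N :: nat
  assumes "N > 0" and f: "set_integrable lborel unit_square f"
    and c: "\<And>T V. c T V \<ge> 0"
    and le: "\<And>T V x y. T < N \<Longrightarrow> V < N \<Longrightarrow> real T / N \<le> x \<Longrightarrow> x \<le> (real T + 1) / N \<Longrightarrow>
      real V / N \<le> y \<Longrightarrow> y \<le> (real V + 1) / N \<Longrightarrow> f (x, y) \<le> c T V"
  shows "(LINT x:unit_square|lborel. f x) \<le> (\<Sum>T<N. \<Sum>V<N. c T V) / (real N)\<^sup>2"
proof -
  define I where "I T = {real T / N..(real T + 1) / N}" for T
  define g where "g z = (\<Sum>T<N. \<Sum>V<N. c T V * indicator (I T \<times> I V) z)" for z :: "real \<times> real"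
  have cell: "I T \<times> I V = cbox (real T / N, real V / N) ((real T + 1) / N, (real V + 1) / N)" for T V
    by (simp add: I_def cbox_Pair_eq)
  have meas: "measure lborel (I T \<times> I V) = 1 / (real N)\<^sup>2" for T V
    unfolding cell content_Pair using assms(1)
    by (simp add: content_real divide_right_mono power2_eq_square flip: diff_divide_distrib)
  have int: "integrable lborel (\<lambda>z. c T V * indicator (I T \<times> I V) z)" for T V
  proof -
    have "emeasure lborel (I T \<times> I V) < \<infinity>"
      unfolding cell by (rule emeasure_bounded_finite) (rule bounded_cbox)
    then show ?thesis
      by (intro integrable_mult_right integrable_real_indicator) (simp add: cell)
  qed
  have "(LINT x:unit_square|lborel. f x) \<le> integral\<^sup>L lborel g"
    unfolding set_lebesgue_integral_def
  proof (rule integral_mono)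
    show "integrable lborel (\<lambda>x. indicat_real unit_square x *\<^sub>R f x)"
      using f by (simp only: set_integrable_def)
    show "integrable lborel g"
      unfolding g_def by (intro Bochner_Integration.integrable_sum int)
    fix z :: "real \<times> real"
    have g0: "0 \<le> g z"
      unfolding g_def by (intro sum_nonneg mult_nonneg_nonneg c) simp
    show "indicat_real unit_square z *\<^sub>R f z \<le> g z"
    proof (cases "z \<in> unit_square")
      case True
      obtain x y where z: "z = (x, y)"
        by (cases z)
      obtain T V where T: "T < N" "x \<in> I T" and V: "V < N" "y \<in> I V"
        using grid_cell_exists[of x N] grid_cell_exists[of y N] True assms(1)
        by (auto simp: z I_def)
      have "f z \<le> c T V"
        unfolding z using T V by (intro le) (simp_all add: I_def)
      also have "\<dots> = c T V * indicator (I T \<times> I V) z"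
        using T V by (simp add: z)
      also have "\<dots> \<le> (\<Sum>V<N. c T V * indicator (I T \<times> I V) z)"
        using V by (intro member_le_sum) (auto simp: c)
      also have "\<dots> \<le> g z"
        unfolding g_def using T
        by (intro member_le_sum[of T _ "\<lambda>T. \<Sum>V<N. c T V * indicator (I T \<times> I V) z"])
          (auto intro!: sum_nonneg simp: c)
      finally show ?thesis
        using True by simp
    qed (simp add: g0)
  qed
  also have "integral\<^sup>L lborel g =
      (\<Sum>T<N. \<integral>z. (\<Sum>V<N. c T V * indicator (I T \<times> I V) z) \<partial>lborel)"
    unfolding g_def
    by (intro Bochner_Integration.integral_sum Bochner_Integration.integrable_sum int)
  also have "\<dots> = (\<Sum>T<N. \<Sum>V<N. \<integral>z. c T V * indicator (I T \<times> I V) z \<partial>lborel)"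
    by (intro sum.cong refl Bochner_Integration.integral_sum int)
  also have "\<dots> = (\<Sum>T<N. \<Sum>V<N. c T V * measure lborel (I T \<times> I V))"
    by simp
  also have "\<dots> = (\<Sum>T<N. \<Sum>V<N. c T V) / (real N)\<^sup>2"
    by (simp add: meas sum_divide_distrib)
  finally show ?thesis .
qed

lemma power2_le_of_abs_diff_le:
  fixes d g :: real
  assumes "\<bar>d - g\<bar> \<le> 2"
  shows "d\<^sup>2 \<le> 2 * g\<^sup>2 + 8"
proof -
  have "(d - g)\<^sup>2 \<le> 4"
    using power_mono[OF assms abs_ge_zero, of 2] by simp
  moreover have "d\<^sup>2 \<le> 2 * g\<^sup>2 + 2 * (d - g)\<^sup>2"
    using zero_le_power2[of "d - 2 * g"] by (simp add: power2_eq_square algebra_simps)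
  ultimately show ?thesis
    by linarith
qed

theorem theorem1p7:
  shows "\<exists>C>0. \<forall>n n0 n1 n2 :: nat.
     n1 > 0 \<longrightarrow> n2 > 0 \<longrightarrow> n0 + n1 + n2 = n \<longrightarrow>
     real n1 / real n2 = 54 / 17 \<longrightarrow> n0 < 568 \<longrightarrow> 6 dvd n1 \<longrightarrow> 8 dvd n2 \<longrightarrow>
     (let k = shift_index n0 n1 n2; \<alpha>\<^sub>0 = 1 - real k / 2 ^ n
      in L2_norm_square (discrepancy (cyclic_shift \<alpha>\<^sub>0 (van_der_corput_set n)))
           \<le> C * sqrt (real n))"
proof (intro exI[of _ "sqrt 31160"] conjI allI impI)
  fix n n0 n1 n2 :: nat
  assume n: "n1 > 0" "n2 > 0" "n0 + n1 + n2 = n" "real n1 / real n2 = 54 / 17" "n0 < 568"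
    "6 dvd n1" "8 dvd n2"
  define k where "k = shift_index n0 n1 n2"
  define A where "A = cyclic_shift (1 - real k / 2 ^ n) (van_der_corput_set n)"
  define G where "G = (\<Sum>T<2 ^ n. \<Sum>V<2 ^ n. (grid_discrepancy n k T V)\<^sup>2)"
  have "real (17 * n1) = real (54 * n2)"
    using n(2,4) by (simp add: field_simps)
  then have "17 * n1 = 54 * n2"
    by (simp only: of_nat_eq_iff)
  then have "\<bar>\<Sum>r<n. drift k r\<bar> \<le> 72"
    unfolding k_def n(3)[symmetric] using n by (intro sum_drift_bounded)
  then have G: "G \<le> 3 * (8 * real n + 72\<^sup>2) * (2 ^ n)\<^sup>2"
    unfolding G_def by (rule sum_square_grid_discrepancy)
  have "finite A"
    by (simp add: A_def cyclic_shift_van_der_corput_set)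
  have "(LINT z:unit_square|lborel. (discrepancy A z)\<^sup>2) \<le>
      (\<Sum>T<2 ^ n. \<Sum>V<2 ^ n. 2 * (grid_discrepancy n k T V)\<^sup>2 + 8) / (real (2 ^ n))\<^sup>2"
  proof (rule integral_unit_square_le_grid_sum)
    show "set_integrable lborel unit_square (\<lambda>z. (discrepancy A z)\<^sup>2)"
      by (rule discrepancy_square_integrable) fact
  next
    fix T V x y
    assume "T < 2 ^ n" "V < 2 ^ n" "real T / real (2 ^ n) \<le> x" "x \<le> (real T + 1) / real (2 ^ n)"
      "real V / real (2 ^ n) \<le> y" "y \<le> (real V + 1) / real (2 ^ n)"
    then have "\<bar>discrepancy A (x, y) - grid_discrepancy n k T V\<bar> \<le> 2"
      unfolding A_def by (rule discrepancy_near_grid)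
    then show "(discrepancy A (x, y))\<^sup>2 \<le> 2 * (grid_discrepancy n k T V)\<^sup>2 + 8"
      by (rule power2_le_of_abs_diff_le)
  qed simp_all
  also have "\<dots> = 2 * (G / (2 ^ n)\<^sup>2) + 8"
    by (simp add: G_def sum.distrib add_divide_distrib power2_eq_square flip: sum_distrib_left)
  also have "G / (2 ^ n)\<^sup>2 \<le> 3 * (8 * real n + 72\<^sup>2)"
    using G by (simp add: divide_le_eq)
  \<comment> \<open>The left side is \<open>48 * n + 31112\<close>, and \<open>n\<close> is at least
    1 because \<open>n1 > 0\<close>; 48 + 31112 = 31160.\<close>
  also have "2 * (3 * (8 * real n + 72\<^sup>2)) + 8 \<le> 31160 * real n"
    using n(1,3) by simp
  finally have "(LINT z:unit_square|lborel. (discrepancy A z)\<^sup>2) \<le> 31160 * real n"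
    by simp
  then have "L2_norm_square (discrepancy A) \<le> sqrt 31160 * sqrt (real n)"
    unfolding L2_norm_square_def real_sqrt_mult[symmetric] by simp
  then show "let k = shift_index n0 n1 n2; \<alpha>\<^sub>0 = 1 - real k / 2 ^ n
      in L2_norm_square (discrepancy (cyclic_shift \<alpha>\<^sub>0 (van_der_corput_set n)))
           \<le> sqrt 31160 * sqrt (real n)"
    by (simp only: Let_def A_def k_def)
qed simp

end
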